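(* Let $A_0,\dots,A_K$ be agents and $\mathcal A\subseteq\{0,\dots,K-1\}$ the set of adopted steps, with $A_{k+1}=A_k$ for $k\notin\mathcal A$. Assume rewards lie in $[0,1]$ and the user-task distribution is fixed and agent-independent. Suppose $Z_k\in(0,1)$ for each $k\in\mathcal A$ and that each adoption satisfies $\widehat L_k\ge\tau$ and $\widehat D_{R,k}\le\delta$ with fixed $\tau,\delta>0$, where $\widehat L_k,\widehat D_{R,k}$ are estimates of $L_{A_k}(A_{k+1})$ and $D_R(A_{k+1};A_k)$. On the event that the error bounds $|\widehat L_k-L_{A_k}(A_{k+1})|\le\varepsilon_L^{(k)}$ and $|\widehat D_{R,k}-D_R(A_{k+1};A_k)|\le\varepsilon_D^{(k)}$ hold for all $k\in\mathcal A$, the accumulated change $$\mathcal V_K:=\sum_{k\in\mathcal A}\mathbb E_{t\sim\mathcal D_{\mathrm{user}}}|V(A_{k+1},t)-V(A_k,t)|$$ satisfies $$\mathcal V_K\le 1-J_{\mathrm{user}}(A_0)+\sum_{k\in\mathcal A}\bigl(Z_k-\tau+\varepsilon_L^{(k)}\bigr)+2\sum_{k\in\mathcal A}(1-Z_k)\bigl(\delta+\varepsilon_D^{(k)}\bigr).$$ Consequently $\mathbb E_{t\sim\mathcal D_{\mathrm{user}}}|V(A_K,t)-V(A_0,t)|\le\min\{1,\mathcal V_K\}$.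
   Context: Tasks $\mathcal T_{\mathrm{user}}$ and outputs $\mathcal O$ are measurable spaces; an agent is a Markov kernel $A(\cdot\mid t)$ from tasks to outputs; reward $r(t,o)\in[0,1]$ and failure detector $\phi(t,o)\in\{0,1\}$ are measurable; $\mathcal D_{\mathrm{user}}$ is a fixed probability measure on tasks. $V(A,t)=\int r(t,o)A(do\mid t)$, $J_{\mathrm{user}}(A)=\mathbb E_{t\sim\mathcal D_{\mathrm{user}}}V(A,t)$, $\psi_A(t)=\int\phi(t,o)A(do\mid t)$, $Z_k=\mathbb E_{\mathcal D_{\mathrm{user}}}\psi_{A_k}$, $\mathcal D_{F,k}(dt)=\frac{\psi_{A_k}(t)}{Z_k}\mathcal D_{\mathrm{user}}(dt)$, $\mathcal D_{R,k}(dt)=\frac{1-\psi_{A_k}(t)}{1-Z_k}\mathcal D_{\mathrm{user}}(dt)$. $L_{A_k}(\widetilde A)=Z_k\mathbb E_{t\sim\mathcal D_{F,k}}[V(\widetilde A,t)-V(A_k,t)]$ and $D_R(\widetilde A;A_k)=\mathbb E_{t\sim\mathcal D_{R,k}}|V(\widetilde A,t)-V(A_k,t)|$. *)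

theory Defs
  imports "HOL-Probability.Probability"
begin

text \<open>
  Tasks and outputs are measurable spaces (only the \<sigma>-algebra of the measures \<open>T\<close>, \<open>Y\<close> is
  relevant); an agent is a Markov kernel, rendered as a measurable map into the probability
  measures with the \<sigma>-algebra generated by the evaluation maps.  The user-task
  distribution is a parameter \<open>D\<close> that does not depend on any agent.
\<close>

abbreviation agents :: "'t measure \<Rightarrow> 'o measure \<Rightarrow> ('t \<Rightarrow> 'o measure) set" where
  "agents T Y \<equiv> T \<rightarrow>\<^sub>M prob_algebra Y"

definition task_value :: "('t \<times> 'o \<Rightarrow> real) \<Rightarrow> ('t \<Rightarrow> 'o measure) \<Rightarrow> 't \<Rightarrow> real" where
  "task_value r A t = (\<integral>y. r (t, y) \<partial>A t)"

definition J_user :: "'t measure \<Rightarrow> ('t \<times> 'o \<Rightarrow> real) \<Rightarrow> ('t \<Rightarrow> 'o measure) \<Rightarrow> real" where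
  "J_user D r A = (\<integral>t. task_value r A t \<partial>D)"

definition fail_prob :: "('t \<times> 'o \<Rightarrow> real) \<Rightarrow> ('t \<Rightarrow> 'o measure) \<Rightarrow> 't \<Rightarrow> real" where
  "fail_prob \<phi> A t = (\<integral>y. \<phi> (t, y) \<partial>A t)"

definition fail_mass :: "'t measure \<Rightarrow> ('t \<times> 'o \<Rightarrow> real) \<Rightarrow> ('t \<Rightarrow> 'o measure) \<Rightarrow> real" where
  "fail_mass D \<phi> A = (\<integral>t. fail_prob \<phi> A t \<partial>D)"

text \<open>
  The next two are probability measures only if \<open>fail_mass D \<phi> A\<close> is nonzero, respectively
  different from 1.
\<close>

definition dist_F :: "'t measure \<Rightarrow> ('t \<times> 'o \<Rightarrow> real) \<Rightarrow> ('t \<Rightarrow> 'o measure) \<Rightarrow> 't measure" where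
  "dist_F D \<phi> A = density D (\<lambda>t. ennreal (fail_prob \<phi> A t / fail_mass D \<phi> A))"

definition dist_R :: "'t measure \<Rightarrow> ('t \<times> 'o \<Rightarrow> real) \<Rightarrow> ('t \<Rightarrow> 'o measure) \<Rightarrow> 't measure" where
  "dist_R D \<phi> A = density D (\<lambda>t. ennreal ((1 - fail_prob \<phi> A t) / (1 - fail_mass D \<phi> A)))"

definition gain_L ::
  "'t measure \<Rightarrow> ('t \<times> 'o \<Rightarrow> real) \<Rightarrow> ('t \<times> 'o \<Rightarrow> real) \<Rightarrow>
     ('t \<Rightarrow> 'o measure) \<Rightarrow> ('t \<Rightarrow> 'o measure) \<Rightarrow> real" where
  "gain_L D r \<phi> A A' =
     fail_mass D \<phi> A * (\<integral>t. (task_value r A' t - task_value r A t) \<partial>dist_F D \<phi> A)"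

definition drift_R ::
  "'t measure \<Rightarrow> ('t \<times> 'o \<Rightarrow> real) \<Rightarrow> ('t \<times> 'o \<Rightarrow> real) \<Rightarrow>
     ('t \<Rightarrow> 'o measure) \<Rightarrow> ('t \<Rightarrow> 'o measure) \<Rightarrow> real" where
  "drift_R D r \<phi> A' A = (\<integral>t. \<bar>task_value r A' t - task_value r A t\<bar> \<partial>dist_R D \<phi> A)"

definition accumulated_change ::
  "'t measure \<Rightarrow> ('t \<times> 'o \<Rightarrow> real) \<Rightarrow> (nat \<Rightarrow> 't \<Rightarrow> 'o measure) \<Rightarrow> nat set \<Rightarrow> real" where
  "accumulated_change D r A adopted =
     (\<Sum>k\<in>adopted. \<integral>t. \<bar>task_value r (A (Suc k)) t - task_value r (A k) t\<bar> \<partial>D)"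

end

theory Submission
  imports Defs
begin

text \<open>
  Write \<open>v = V(A\<^bsub>k+1\<^esub>, t) - V(A\<^bsub>k\<^esub>, t)\<close> and let \<open>p\<close> be the failure probability of \<open>A\<^bsub>k\<^esub>\<close> on \<open>t\<close>.
  Since \<open>\<bar>v\<bar> \<le> 1\<close> and \<open>0 \<le> p \<le> 1\<close>, one has \<open>\<bar>v\<bar> \<le> v + p (1 - v) + 2 (1 - p) \<bar>v\<bar>\<close>.
  Integrating over tasks bounds the change in one step by
  \<open>J(A\<^bsub>k+1\<^esub>) - J(A\<^bsub>k\<^esub>) + Z\<^bsub>k\<^esub> - L + 2 (1 - Z\<^bsub>k\<^esub>) D\<^bsub>R\<^esub>\<close>, and the differences of \<open>J\<close> telescope
  because steps that are not adopted leave the agent unchanged.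
\<close>

lemma agents_imp_prob_space:
  assumes "A \<in> agents T Y" "t \<in> space T"
  shows "prob_space (A t)" "sets (A t) = sets Y"
  using measurable_space[OF assms] by (auto simp: space_prob_algebra)

text \<open>Both the integrand and the measure vary with \<open>t\<close>. Pushing
  \<open>A t\<close> forward along \<open>y\<close> to \<open>(t, y)\<close> moves all dependence on
  \<open>t\<close> into the measure: the integrand becomes the fixed function \<open>f\<close> on
  the product, and the pushforward is a measurable function of \<open>t\<close>.\<close>

lemma measurable_kernel_integral:
  fixes f :: "'t \<times> 'o \<Rightarrow> real"
  assumes f[measurable]: "f \<in> borel_measurable (T \<Otimes>\<^sub>M Y)" and A: "A \<in> agents T Y"
  shows "(\<lambda>t. \<integral>y. f (t, y) \<partial>A t) \<in> borel_measurable T"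
proof -
  note [measurable] = measurable_prob_algebraD[OF A] measurable_distr2
  have "(\<lambda>t. \<integral>x. f x \<partial>distr (A t) (T \<Otimes>\<^sub>M Y) (\<lambda>y. (t, y))) \<in> borel_measurable T"
    by measurable
  moreover have "(\<integral>x. f x \<partial>distr (A t) (T \<Otimes>\<^sub>M Y) (\<lambda>y. (t, y))) = (\<integral>y. f (t, y) \<partial>A t)"
    if t: "t \<in> space T" for t
    using agents_imp_prob_space(2)[OF A t] t
    by (intro integral_distr) (auto cong: measurable_cong_sets)
  ultimately show ?thesis
    by (simp cong: measurable_cong)
qed

lemma kernel_integral_range:
  fixes f :: "'t \<times> 'o \<Rightarrow> real"
  assumes f: "f \<in> borel_measurable (T \<Otimes>\<^sub>M Y)"
    and range: "\<And>x. x \<in> space (T \<Otimes>\<^sub>M Y) \<Longrightarrow> f x \<in> {0..1}"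
    and A: "A \<in> agents T Y" and t: "t \<in> space T"
  shows "(\<integral>y. f (t, y) \<partial>A t) \<in> {0..1}"
proof -
  interpret prob_space "A t"
    using agents_imp_prob_space[OF A t] by simp
  have sets: "sets (A t) = sets Y"
    using agents_imp_prob_space[OF A t] by simp
  have space: "space (A t) = space Y"
    by (rule sets_eq_imp_space_eq[OF sets])
  have r: "f (t, y) \<in> {0..1}" if "y \<in> space (A t)" for y
    using range[of "(t, y)"] that t by (simp add: space space_pair_measure)
  have "(\<lambda>y. f (t, y)) \<in> borel_measurable (A t)"
    using f t by (simp cong: measurable_cong_sets[OF sets refl])
  then have int: "integrable (A t) (\<lambda>y. f (t, y))"
    using r by (intro integrable_const_bound[of _ 1]) auto
  have "(\<integral>y. f (t, y) \<partial>A t) \<le> (\<integral>y. 1 \<partial>A t)"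
    using int r by (intro integral_mono) auto
  moreover have "0 \<le> (\<integral>y. f (t, y) \<partial>A t)"
    using r by (intro Bochner_Integration.integral_nonneg) auto
  ultimately show ?thesis
    by (simp add: prob_space)
qed

text \<open>Right side minus left side is p (1 - |v|) + 2 (1 - p) |v| for v >= 0 and exactly p (1 -
  |v|) for v < 0. The negative case explains the factor 2: trading v for |v| there costs 2
  |v|.\<close>

lemma abs_le_failure_split:
  fixes p v :: real
  assumes "0 \<le> p" "p \<le> 1" "\<bar>v\<bar> \<le> 1"
  shows "\<bar>v\<bar> \<le> v + p * (1 - v) + 2 * ((1 - p) * \<bar>v\<bar>)"
proof -
  have "0 \<le> p * (1 - \<bar>v\<bar>)" "0 \<le> (1 - p) * \<bar>v\<bar>"
    using assms by auto
  then show ?thesis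
    by (cases "v \<ge> 0") (auto simp: algebra_simps)
qed

text \<open>The detector takes values in the interval \<open>{0..1}\<close>, like the reward, so
  that \<open>kernel_integral_range\<close> serves both; a binary detector is an instance.\<close>

locale evaluation = prob_space D
  for T :: "'t measure" and Y :: "'o measure" and D :: "'t measure"
    and r \<phi> :: "'t \<times> 'o \<Rightarrow> real" +
  assumes sets_D: "sets D = sets T"
    and reward_measurable: "r \<in> borel_measurable (T \<Otimes>\<^sub>M Y)"
    and reward_range: "\<And>x. x \<in> space (T \<Otimes>\<^sub>M Y) \<Longrightarrow> r x \<in> {0..1}"
    and detector_measurable: "\<phi> \<in> borel_measurable (T \<Otimes>\<^sub>M Y)"
    and detector_range: "\<And>x. x \<in> space (T \<Otimes>\<^sub>M Y) \<Longrightarrow> \<phi> x \<in> {0..1}"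
begin

lemma space_D: "space D = space T"
  by (rule sets_eq_imp_space_eq[OF sets_D])

lemma task_value_measurable: "A \<in> agents T Y \<Longrightarrow> task_value r A \<in> borel_measurable D"
  using measurable_kernel_integral[OF reward_measurable]
  by (simp add: task_value_def[abs_def] cong: measurable_cong_sets[OF sets_D refl])

lemma fail_prob_measurable: "A \<in> agents T Y \<Longrightarrow> fail_prob \<phi> A \<in> borel_measurable D"
  using measurable_kernel_integral[OF detector_measurable]
  by (simp add: fail_prob_def[abs_def] cong: measurable_cong_sets[OF sets_D refl])

lemma task_value_range:
  "A \<in> agents T Y \<Longrightarrow> t \<in> space D \<Longrightarrow> 0 \<le> task_value r A t \<and> task_value r A t \<le> 1"
  using kernel_integral_range[OF reward_measurable reward_range]
  by (simp add: task_value_def space_D)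

lemma fail_prob_range:
  "A \<in> agents T Y \<Longrightarrow> t \<in> space D \<Longrightarrow> 0 \<le> fail_prob \<phi> A t \<and> fail_prob \<phi> A t \<le> 1"
  using kernel_integral_range[OF detector_measurable detector_range]
  by (simp add: fail_prob_def space_D)

lemma task_value_diff_le_1:
  assumes "A \<in> agents T Y" "A' \<in> agents T Y" "t \<in> space D"
  shows "\<bar>task_value r A' t - task_value r A t\<bar> \<le> 1"
  using task_value_range[OF assms(1,3)] task_value_range[OF assms(2,3)] by auto

lemma integrable_task_value: "A \<in> agents T Y \<Longrightarrow> integrable D (task_value r A)"
  using task_value_range task_value_measurable
  by (intro integrable_const_bound[of _ 1]) (auto intro!: AE_I2)

lemma integrable_fail_prob: "A \<in> agents T Y \<Longrightarrow> integrable D (fail_prob \<phi> A)"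
  using fail_prob_range fail_prob_measurable
  by (intro integrable_const_bound[of _ 1]) (auto intro!: AE_I2)

lemma J_user_le_1:
  assumes "A \<in> agents T Y"
  shows "J_user D r A \<le> 1"
proof -
  have "(\<integral>t. task_value r A t \<partial>D) \<le> (\<integral>t. 1 \<partial>D)"
    using assms task_value_range integrable_task_value by (intro integral_mono) auto
  then show ?thesis
    by (simp add: J_user_def prob_space)
qed

text \<open>The prefactor \<open>fail_mass D \<phi> A\<close> cancels the normalisation inside
  \<open>dist_F\<close>. Its positivity justifies the cancellation and keeps the density
  nonnegative, so that passing through \<open>ennreal\<close> does not truncate it.\<close>

lemma gain_L_eq:
  assumes A: "A \<in> agents T Y" "A' \<in> agents T Y" and Z: "fail_mass D \<phi> A > 0"
  shows "gain_L D r \<phi> A A' =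
    (\<integral>t. fail_prob \<phi> A t * (task_value r A' t - task_value r A t) \<partial>D)"
proof -
  note [measurable] = fail_prob_measurable[OF A(1)] task_value_measurable[OF A(1)]
    task_value_measurable[OF A(2)]
  have "(\<integral>t. (task_value r A' t - task_value r A t) \<partial>dist_F D \<phi> A) =
    (\<integral>t. fail_prob \<phi> A t / fail_mass D \<phi> A * (task_value r A' t - task_value r A t) \<partial>D)"
    unfolding dist_F_def using Z fail_prob_range[OF A(1)]
    by (subst integral_real_density) (auto intro!: AE_I2)
  also have "\<dots> =
    (\<integral>t. fail_prob \<phi> A t * (task_value r A' t - task_value r A t) / fail_mass D \<phi> A \<partial>D)"
    by simp
  finally show ?thesis
    using Z by (simp add: gain_L_def)
qed

text \<open>The complementary identity: the weight \<open>1 - fail_mass D \<phi> A\<close> cancels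
  the normalisation of \<open>dist_R\<close>, and is positive because the failure mass is below
  1.\<close>

lemma drift_R_eq:
  assumes A: "A \<in> agents T Y" "A' \<in> agents T Y" and Z: "fail_mass D \<phi> A < 1"
  shows "(1 - fail_mass D \<phi> A) * drift_R D r \<phi> A' A =
    (\<integral>t. (1 - fail_prob \<phi> A t) * \<bar>task_value r A' t - task_value r A t\<bar> \<partial>D)"
proof -
  note [measurable] = fail_prob_measurable[OF A(1)] task_value_measurable[OF A(1)]
    task_value_measurable[OF A(2)]
  have "drift_R D r \<phi> A' A =
    (\<integral>t. (1 - fail_prob \<phi> A t) / (1 - fail_mass D \<phi> A)
      * \<bar>task_value r A' t - task_value r A t\<bar> \<partial>D)"
    unfolding drift_R_def dist_R_def using Z fail_prob_range[OF A(1)]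
    by (subst integral_real_density) (auto intro!: AE_I2)
  also have "\<dots> =
    (\<integral>t. (1 - fail_prob \<phi> A t) * \<bar>task_value r A' t - task_value r A t\<bar>
      / (1 - fail_mass D \<phi> A) \<partial>D)"
    by simp
  finally show ?thesis
    using Z by simp
qed

lemma step_change_le:
  assumes A: "A \<in> agents T Y" "A' \<in> agents T Y" and Z: "fail_mass D \<phi> A \<in> {0<..<1}"
  shows "(\<integral>t. \<bar>task_value r A' t - task_value r A t\<bar> \<partial>D) \<le>
    J_user D r A' - J_user D r A + (fail_mass D \<phi> A - gain_L D r \<phi> A A')
      + 2 * ((1 - fail_mass D \<phi> A) * drift_R D r \<phi> A' A)"
proof -
  note [measurable] = fail_prob_measurable[OF A(1)] task_value_measurable[OF A(1)]
    task_value_measurable[OF A(2)]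
  define v where "v t = task_value r A' t - task_value r A t" for t
  define p where "p = fail_prob \<phi> A"
  have v[measurable]: "v \<in> borel_measurable D" and p[measurable]: "p \<in> borel_measurable D"
    unfolding v_def[abs_def] p_def by measurable
  have bounds: "\<bar>v t\<bar> \<le> 1" "0 \<le> p t" "p t \<le> 1" if "t \<in> space D" for t
    using task_value_diff_le_1[OF A that] fail_prob_range[OF A(1) that] by (auto simp: v_def p_def)
  have int_v: "integrable D v"
    using bounds by (intro integrable_const_bound[of _ 1]) (auto intro!: AE_I2)
  have int_p: "integrable D p"
    unfolding p_def by (rule integrable_fail_prob[OF A(1)])
  have int_pv: "integrable D (\<lambda>t. p t * v t)"
    using bounds
    by (intro integrable_const_bound[of _ 1]) (auto intro!: AE_I2 mult_le_one simp: abs_mult)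
  have int_qv: "integrable D (\<lambda>t. (1 - p t) * \<bar>v t\<bar>)"
    using bounds
    by (intro integrable_const_bound[of _ 1]) (auto intro!: AE_I2 mult_le_one simp: abs_mult)
  \<comment> \<open>The term p (1 - v) is expanded to p - p v, because the two pieces integrate
    separately to the failure mass and to \<open>gain_L\<close>.\<close>
  have "(\<integral>t. \<bar>v t\<bar> \<partial>D) \<le> (\<integral>t. v t + (p t - p t * v t) + 2 * ((1 - p t) * \<bar>v t\<bar>) \<partial>D)"
  proof (rule integral_mono)
    fix t assume "t \<in> space D"
    from abs_le_failure_split[OF bounds(2,3,1)[OF this]]
    show "\<bar>v t\<bar> \<le> v t + (p t - p t * v t) + 2 * ((1 - p t) * \<bar>v t\<bar>)"
      by (simp add: algebra_simps)
  qed (use int_v int_p int_pv int_qv in auto)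
  also have "\<dots> = (\<integral>t. v t \<partial>D) + ((\<integral>t. p t \<partial>D) - (\<integral>t. p t * v t \<partial>D))
      + 2 * (\<integral>t. (1 - p t) * \<bar>v t\<bar> \<partial>D)"
    using int_v int_p int_pv int_qv by simp
  also have "(\<integral>t. v t \<partial>D) = J_user D r A' - J_user D r A"
    using A by (simp add: v_def J_user_def integrable_task_value)
  finally show ?thesis
    using Z gain_L_eq[OF A] drift_R_eq[OF A] by (simp add: v_def p_def fail_mass_def)
qed

end

theorem proposition1:
  fixes T :: "'t measure" and Y :: "'o measure" and D :: "'t measure"
    and r \<phi> :: "'t \<times> 'o \<Rightarrow> real"
    and K :: nat and A :: "nat \<Rightarrow> 't \<Rightarrow> 'o measure" and adopted :: "nat set"
    and L_hat D_hat \<epsilon>\<^sub>L \<epsilon>\<^sub>D :: "nat \<Rightarrow> real" and \<tau> \<delta> :: real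
  assumes user_dist: "prob_space D" "sets D = sets T"
    and reward_measurable: "r \<in> borel_measurable (T \<Otimes>\<^sub>M Y)"
    and reward_range: "\<And>x. x \<in> space (T \<Otimes>\<^sub>M Y) \<Longrightarrow> r x \<in> {0..1}"
    and detector_measurable: "\<phi> \<in> borel_measurable (T \<Otimes>\<^sub>M Y)"
    and detector_range: "\<And>x. x \<in> space (T \<Otimes>\<^sub>M Y) \<Longrightarrow> \<phi> x \<in> {0, 1}"
    and agents: "\<And>k. k \<le> K \<Longrightarrow> A k \<in> agents T Y"
    and adopted_steps: "adopted \<subseteq> {..<K}"
    and not_adopted: "\<And>k t. k < K \<Longrightarrow> k \<notin> adopted \<Longrightarrow> t \<in> space T \<Longrightarrow> A (Suc k) t = A k t"
    and Z_range: "\<And>k. k \<in> adopted \<Longrightarrow> fail_mass D \<phi> (A k) \<in> {0<..<1}"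
    and thresholds: "\<tau> > 0" "\<delta> > 0"
    and adoption_L: "\<And>k. k \<in> adopted \<Longrightarrow> L_hat k \<ge> \<tau>"
    and adoption_D: "\<And>k. k \<in> adopted \<Longrightarrow> D_hat k \<le> \<delta>"
    and error_L: "\<And>k. k \<in> adopted \<Longrightarrow> \<bar>L_hat k - gain_L D r \<phi> (A k) (A (Suc k))\<bar> \<le> \<epsilon>\<^sub>L k"
    and error_D: "\<And>k. k \<in> adopted \<Longrightarrow> \<bar>D_hat k - drift_R D r \<phi> (A (Suc k)) (A k)\<bar> \<le> \<epsilon>\<^sub>D k"
  shows "accumulated_change D r A adopted
           \<le> 1 - J_user D r (A 0)
             + (\<Sum>k\<in>adopted. fail_mass D \<phi> (A k) - \<tau> + \<epsilon>\<^sub>L k)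
             + 2 * (\<Sum>k\<in>adopted. (1 - fail_mass D \<phi> (A k)) * (\<delta> + \<epsilon>\<^sub>D k))
         \<and> (\<integral>t. \<bar>task_value r (A K) t - task_value r (A 0) t\<bar> \<partial>D)
           \<le> min 1 (accumulated_change D r A adopted)"
proof -
  interpret evaluation T Y D r \<phi>
    using user_dist reward_measurable reward_range detector_measurable detector_range
    by (intro evaluation.intro evaluation_axioms.intro) force+
  define c where "c k = (\<integral>t. \<bar>task_value r (A (Suc k)) t - task_value r (A k) t\<bar> \<partial>D)" for k
  have change: "accumulated_change D r A adopted = (\<Sum>k\<in>adopted. c k)"
    by (simp add: accumulated_change_def c_def)
  \<comment> \<open>The kernels of a step that is not adopted agree only on the task space; this
    suffices for integrals over \<open>D\<close>, whose space is the same.\<close>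
  have same: "task_value r (A (Suc k)) t = task_value r (A k) t"
    if "k \<in> {..<K} - adopted" "t \<in> space D" for k t
    using that not_adopted[of k t] by (simp add: task_value_def space_D)
  have "c k = 0" if "k \<in> {..<K} - adopted" for k
    unfolding c_def using same[OF that]
    by (subst Bochner_Integration.integral_cong[OF refl, of _ _ "\<lambda>_. 0"]) auto
  \<comment> \<open>Two forms of the accumulated change are kept: the sum over
    \<open>adopted\<close> matches the per-step bound, the sum over all k < K matches the
    telescoping path from \<open>A 0\<close> to \<open>A K\<close>.\<close>
  then have change': "accumulated_change D r A adopted = (\<Sum>k<K. c k)"
    unfolding change using adopted_steps by (intro sum.mono_neutral_left) auto
  have J_same: "J_user D r (A (Suc k)) - J_user D r (A k) = 0" if "k \<in> {..<K} - adopted" for k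
    unfolding J_user_def using same[OF that] by (simp cong: Bochner_Integration.integral_cong)
  have step: "c k \<le> J_user D r (A (Suc k)) - J_user D r (A k)
      + (fail_mass D \<phi> (A k) - \<tau> + \<epsilon>\<^sub>L k)
      + 2 * ((1 - fail_mass D \<phi> (A k)) * (\<delta> + \<epsilon>\<^sub>D k))" if k: "k \<in> adopted" for k
  proof -
    have ag: "A k \<in> agents T Y" "A (Suc k) \<in> agents T Y"
      using agents adopted_steps k by auto
    \<comment> \<open>The true drift is at most \<open>D_hat k + \<epsilon>\<^sub>D k\<close>, hence
      at most \<open>\<delta> + \<epsilon>\<^sub>D k\<close>; the nonnegative weight preserves this.
      In the same way the true gain is at least
      \<open>\<tau> - \<epsilon>\<^sub>L k\<close>.\<close>
    have "(1 - fail_mass D \<phi> (A k)) * drift_R D r \<phi> (A (Suc k)) (A k)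
        \<le> (1 - fail_mass D \<phi> (A k)) * (\<delta> + \<epsilon>\<^sub>D k)"
      using Z_range[OF k] adoption_D[OF k] error_D[OF k] by (intro mult_left_mono) auto
    then show ?thesis
      using step_change_le[OF ag Z_range[OF k]] adoption_L[OF k] error_L[OF k]
      unfolding c_def by linarith
  qed
  \<comment> \<open>The adopted steps may leave gaps, so the sum is first padded with the zero
    increments of the other steps and telescopes only then.\<close>
  have "(\<Sum>k\<in>adopted. J_user D r (A (Suc k)) - J_user D r (A k))
      = (\<Sum>k<K. J_user D r (A (Suc k)) - J_user D r (A k))"
    using adopted_steps J_same by (intro sum.mono_neutral_left) auto
  also have "\<dots> = J_user D r (A K) - J_user D r (A 0)"
    by (rule sum_lessThan_telescope)
  also have "\<dots> \<le> 1 - J_user D r (A 0)"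
    using J_user_le_1[OF agents[of K]] by simp
  finally have bound: "accumulated_change D r A adopted
           \<le> 1 - J_user D r (A 0)
             + (\<Sum>k\<in>adopted. fail_mass D \<phi> (A k) - \<tau> + \<epsilon>\<^sub>L k)
             + 2 * (\<Sum>k\<in>adopted. (1 - fail_mass D \<phi> (A k)) * (\<delta> + \<epsilon>\<^sub>D k))"
    using sum_mono[of adopted c, OF step] unfolding change
    by (simp add: sum.distrib sum_distrib_left)
  have int: "integrable D (\<lambda>t. \<bar>task_value r (A j) t - task_value r (A i) t\<bar>)"
    if "i \<le> K" "j \<le> K" for i j
    using that agents integrable_task_value by auto
  \<comment> \<open>Pointwise triangle inequality along the chain of agents, then exchange of the
    integral with the finite sum.\<close>
  have "(\<integral>t. \<bar>task_value r (A K) t - task_value r (A 0) t\<bar> \<partial>D)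
      \<le> (\<integral>t. (\<Sum>k<K. \<bar>task_value r (A (Suc k)) t - task_value r (A k) t\<bar>) \<partial>D)"
  proof (rule integral_mono)
    show "\<bar>task_value r (A K) t - task_value r (A 0) t\<bar>
        \<le> (\<Sum>k<K. \<bar>task_value r (A (Suc k)) t - task_value r (A k) t\<bar>)" for t
      using sum_abs[of "\<lambda>k. task_value r (A (Suc k)) t - task_value r (A k) t" "{..<K}"]
      by (simp only: sum_lessThan_telescope[of "\<lambda>k. task_value r (A k) t"])
  qed (use int in auto)
  also have "\<dots> = accumulated_change D r A adopted"
    unfolding change' c_def using int by (intro Bochner_Integration.integral_sum) auto
  finally have total: "(\<integral>t. \<bar>task_value r (A K) t - task_value r (A 0) t\<bar> \<partial>D)
      \<le> accumulated_change D r A adopted" .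
  \<comment> \<open>The other half of the minimum: two values in the unit interval differ by at most
    1, and \<open>D\<close> has total mass 1.\<close>
  have "(\<integral>t. \<bar>task_value r (A K) t - task_value r (A 0) t\<bar> \<partial>D) \<le> (\<integral>t. 1 \<partial>D)"
    using int task_value_diff_le_1 agents by (intro integral_mono) auto
  then show ?thesis
    using bound total by (simp add: prob_space)
qed

end
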